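(* Thompson's group $T$ is a maximal subgroup of Thompson's group $V$; that is, $T \neq V$ and there is no subgroup $H$ with $T \subsetneq H \subsetneq V$.
   Context: Let $\mathfrak{C} = \{0,1\}^{\omega}$ be Cantor space, the set of infinite sequences over $\{0,1\}$. Let $\Omega = \{0,1\}^{*}$ be the set of finite words over $\{0,1\}$, called addresses. For $\alpha \in \Omega$, the cone at $\alpha$ is $\alpha\mathfrak{C} = \{\alpha w : w \in \mathfrak{C}\}$. The lexicographic order on pairwise incomparable addresses (neither a prefix of the other) is: $\alpha < \beta$ when at the first position where they differ $\alpha$ has $0$ and $\beta$ has $1$. Thompson's group $V$ is the group, under composition, of all prefix substitution maps: given two finite collections of cones $\alpha_1\mathfrak{C},\dots,\alpha_n\mathfrak{C}$ and $\beta_1\mathfrak{C},\dots,\beta_n\mathfrak{C}$, each forming a partition of $\mathfrak{C}$ into pairwise disjoint sets, the associated prefix substitution map $g:\mathfrak{C}\to\mathfrak{C}$ is given by $\alpha_i w \mapsto \beta_i w$ for all $i=1,\dots,n$ and $w\in\mathfrak{C}$. Maps act on the right. Thompson's group $T$ is the subgroup of $V$ consisting of those transformations that can be viewed as maps on the circle, i.e. those preserving the cyclic order: $g \in V$ lies in $T$ if and only if there are $n \ge 1$, two partitions of $\mathfrak{C}$ into cones with addresses $\alpha_1<\dots<\alpha_n$ and $\gamma_1<\dots<\gamma_n$ (in lexicographic order), and an integer $k$ such that $g$ maps $\alpha_i w \mapsto \gamma_{i+k} w$ for all $i$ and all $w \in \mathfrak{C}$, with indices read modulo $n$. *)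

theory Defs
  imports "HOL-Library.Stream" "HOL-Library.Disjoint_Sets" "HOL-Algebra.Group"
begin

text \<open>The letters 0 and 1 are encoded as \<^term>\<open>False\<close> and \<^term>\<open>True\<close>, so Cantor space is the
  type \<^typ>\<open>bool stream\<close> and the set of finite words is the type \<^typ>\<open>bool list\<close>.\<close>

type_synonym cantor = "bool stream"
type_synonym address = "bool list"

definition cone :: "address \<Rightarrow> cantor set" where
  "cone a = {a @- w | w. True}"

text \<open>The relation below holds only between incomparable addresses: a proper prefix of an address
  is not related to it, unlike in the usual lexicographic order on words.\<close>

definition addr_less :: "address \<Rightarrow> address \<Rightarrow> bool" where
  "addr_less a b \<longleftrightarrow> (\<exists>u v w. a = u @ False # v \<and> b = u @ True # w)"

text \<open>A partition is given by the list of addresses of its cones.  Disjointness is indexed by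
  positions in the list, so that repeated addresses are excluded.\<close>

definition cone_partition :: "address list \<Rightarrow> bool" where
  "cone_partition as \<longleftrightarrow>
     disjoint_family_on (\<lambda>i. cone (as ! i)) {..<length as} \<and>
     (\<Union>i<length as. cone (as ! i)) = UNIV"

definition is_prefix_substitution :: "address list \<Rightarrow> address list \<Rightarrow> (cantor \<Rightarrow> cantor) \<Rightarrow> bool" where
  "is_prefix_substitution as bs g \<longleftrightarrow>
     cone_partition as \<and> cone_partition bs \<and> length as = length bs \<and>
     (\<forall>i<length as. \<forall>w. g (as ! i @- w) = bs ! i @- w)"

text \<open>Maps act on the right: the product of \<^term>\<open>f\<close> and \<^term>\<open>g\<close> is \<^term>\<open>f\<close> followed by
  \<^term>\<open>g\<close>.\<close>

definition thompson_V :: "(cantor \<Rightarrow> cantor) monoid" where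
  "thompson_V =
     \<lparr>carrier = {g. \<exists>as bs. is_prefix_substitution as bs g},
      mult = (\<lambda>f g. g \<circ> f),
      one = id\<rparr>"

text \<open>Positions are counted from 0, so reading indices modulo \<^term>\<open>n\<close> means reducing them to
  the range from 0 to \<^term>\<open>n - 1\<close>.\<close>

definition thompson_T :: "(cantor \<Rightarrow> cantor) set" where
  "thompson_T =
     {g \<in> carrier thompson_V.
        \<exists>(n::nat) as cs (k::int).
          n \<ge> 1 \<and> length as = n \<and> length cs = n \<and>
          cone_partition as \<and> cone_partition cs \<and>
          sorted_wrt addr_less as \<and> sorted_wrt addr_less cs \<and>
          (\<forall>i<n. \<forall>w. g (as ! i @- w) = cs ! nat ((int i + k) mod int n) @- w)}"

locale maximal_subgroup = subgroup H G + group G for H and G (structure) +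
  assumes proper: "H \<noteq> carrier G"
    and maximal: "\<not> (\<exists>K. subgroup K G \<and> H \<subset> K \<and> K \<subset> carrier G)"

end

theory Submission
  imports Defs "HOL-Library.List_Lexorder" "HOL-Combinatorics.Permutations"
begin

text \<open>
  Let \<open>K\<close> be a subgroup of V that properly contains T.  The aim is to show that \<open>K\<close> contains
  every swap of two disjoint cones.  This suffices: an element of V is an order-preserving
  matching of the cones of two partitions, which lies in T, followed by a permutation of the cones of the
  second one, and permutations
  are products of transpositions (\<open>cone_permutation_in\<close>, \<open>eq_V\<close>).

  For disjoint cones \<open>b\<close> and \<open>c\<close>, the slide of the ordered pair \<open>(b, c)\<close> maps \<open>b0 \<mapsto> b\<close>,
  \<open>b1 \<mapsto> c0\<close>, \<open>c \<mapsto> c1\<close> and fixes everything else; it is the standard generator of Thompson's group F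
  acting on the concatenation of the two cones.  If \<open>c\<close> follows \<open>b\<close> immediately in the cyclic
  order, the slide lies in T.  An element \<open>g\<close> of V outside T has a discontinuity: it sends two cones
  that are adjacent in this sense to cones with a gap between them (\<open>discontinuity_exists\<close>).
  Conjugating by \<open>g\<close> the slide of two adjacent smaller cones gives an element of \<open>K\<close> that is the slide
  of a separated pair, that is, one with a gap on both sides.  Since T is transitive on separated
  ordered pairs (\<open>thompson_T_transitive\<close>), \<open>K\<close> contains the slides of all of them.

  The slide of \<open>(b, c)\<close> followed by the slide of \<open>(c, b)\<close> is the 3-cycle
  \<open>b0 \<mapsto> b1 \<mapsto> c \<mapsto> b0\<close>, and two such 3-cycles compose to the double transposition
  that exchanges \<open>b0\<close> with \<open>c0\<close> and \<open>b1\<close> with \<open>c1\<close>, which is the swap of \<open>b\<close> and \<open>c\<close>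
  (\<open>swap_of_slides\<close>).  This yields the swaps of separated pairs; an arbitrary swap is the product
  of the swaps of \<open>(b0, c0)\<close> and of \<open>(b1, c1)\<close>, which are separated pairs.

  That T is a proper subgroup follows from its description as the stabilizer in V of the ternary
  cyclic order relation on Cantor space (\<open>thompson_T_iff_cyc\<close>).
\<close>

section \<open>Cones and partitions into cones\<close>

lemma in_cone_shift [simp]: "a @- w \<in> cone a"
  by (auto simp: cone_def)

lemma cone_iff: "s \<in> cone a \<longleftrightarrow> (\<exists>w. s = a @- w)"
  by (auto simp: cone_def)

lemma shift_inj [simp]: "a @- v = a @- w \<longleftrightarrow> v = w"
  by (induction a) auto

lemma in_cone_snoc [simp]: "a @- w \<in> cone (a @ [c]) \<longleftrightarrow> shd w = c"
proof
  assume "shd w = c"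
  then have "w = c ## stl w" by (cases w) auto
  then have "a @- w = (a @ [c]) @- stl w" by (metis shift.simps shift_append)
  then show "a @- w \<in> cone (a @ [c])" by (metis in_cone_shift)
qed (auto simp: cone_iff)

lemma cone_append_subset: "cone (a @ c) \<subseteq> cone a"
  by (auto simp: cone_iff)

lemma cone_split: "s \<in> cone a \<longleftrightarrow> s \<in> cone (a @ [False]) \<or> s \<in> cone (a @ [True])"
proof
  assume "s \<in> cone a"
  then obtain w where s: "s = a @- w" by (auto simp: cone_iff)
  show "s \<in> cone (a @ [False]) \<or> s \<in> cone (a @ [True])" by (simp add: s)
qed (use cone_append_subset in blast)

lemma cone_split_disjoint: "\<not> (s \<in> cone (a @ [False]) \<and> s \<in> cone (a @ [True]))"
  by (auto simp: cone_iff)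

text \<open>Counting the cones that contain a given sequence turns invariance of the notion under
  reordering and under subdivision of a cone into a computation.\<close>

lemma cone_partition_iff_count:
  "cone_partition as \<longleftrightarrow> (\<forall>s. length (filter (\<lambda>a. s \<in> cone a) as) = 1)"
proof -
  have "length (filter (\<lambda>a. s \<in> cone a) as) = 1 \<longleftrightarrow> (\<exists>!i. i < length as \<and> s \<in> cone (as ! i))" for s
    by (simp add: length_filter_conv_card card_1_singleton_iff Ex1_def set_eq_iff) blast
  moreover have "cone_partition as \<longleftrightarrow> (\<forall>s. \<exists>!i. i < length as \<and> s \<in> cone (as ! i))"
    unfolding cone_partition_def disjoint_family_on_def
    by (simp add: set_eq_iff Ex1_def) blast
  ultimately show ?thesis by simp
qed

lemma cone_partition_mset: "mset as = mset bs \<Longrightarrow> cone_partition as \<longleftrightarrow> cone_partition bs"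
  unfolding cone_partition_iff_count by (metis mset_filter size_mset)

lemma cone_partition_split:
  "cone_partition (P @ a # Q) \<longleftrightarrow> cone_partition (P @ (a @ [False]) # (a @ [True]) # Q)"
proof -
  have "length (filter (\<lambda>a. s \<in> cone a) (P @ a # Q)) =
        length (filter (\<lambda>a. s \<in> cone a) (P @ (a @ [False]) # (a @ [True]) # Q))" for s
    using cone_split[of s a] cone_split_disjoint[of s a] by auto
  then show ?thesis unfolding cone_partition_iff_count by simp
qed

lemma cone_partitionD:
  assumes "cone_partition as" "i < length as" "j < length as" "s \<in> cone (as ! i)" "s \<in> cone (as ! j)"
  shows "i = j"
  using assms unfolding cone_partition_def disjoint_family_on_def by auto

lemma cone_partition_obtain:
  assumes "cone_partition as"
  obtains i w where "i < length as" "s = as ! i @- w"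
proof -
  have "s \<in> (\<Union>i<length as. cone (as ! i))" using assms unfolding cone_partition_def by simp
  then show thesis using that by (auto simp: cone_iff)
qed

lemma cone_partition_distinct: "cone_partition as \<Longrightarrow> distinct as"
  by (metis cone_partitionD distinct_conv_nth in_cone_shift)

lemma cone_partition_disjoint:
  assumes "cone_partition as" "a \<in> set as" "b \<in> set as" "a \<noteq> b"
  shows "cone a \<inter> cone b = {}"
  using assms by (metis cone_partitionD disjoint_iff in_set_conv_nth)

lemma cone_partition_not_Nil: "cone_partition as \<Longrightarrow> as \<noteq> []"
  by (auto simp: cone_partition_def)

lemma cone_partitionI:
  assumes "distinct as"
    and "\<And>a b s. a \<in> set as \<Longrightarrow> b \<in> set as \<Longrightarrow> s \<in> cone a \<Longrightarrow> s \<in> cone b \<Longrightarrow> a = b"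
    and "\<And>s. \<exists>a\<in>set as. s \<in> cone a"
  shows "cone_partition as"
  unfolding cone_partition_def disjoint_family_on_def
proof (intro conjI ballI impI)
  fix i j assume "i \<in> {..<length as}" "j \<in> {..<length as}" "i \<noteq> j"
  then show "cone (as ! i) \<inter> cone (as ! j) = {}"
    using assms(1,2) by (auto simp: distinct_conv_nth) (metis nth_mem)
next
  show "(\<Union>i<length as. cone (as ! i)) = UNIV"
  proof (rule UNIV_eq_I[symmetric])
    fix s
    obtain a where "a \<in> set as" "s \<in> cone a" using assms(3) by blast
    then show "s \<in> (\<Union>i<length as. cone (as ! i))" by (auto simp: in_set_conv_nth)
  qed
qed

lemma cone_partition_words:
  obtains as where "cone_partition as" "set as = {a. length a = n}"
proof -
  have "finite {a :: address. length a = n}"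
    using finite_lists_length_eq[of "UNIV :: bool set" n] by simp
  then obtain as :: "address list" where as: "set as = {a. length a = n}" "distinct as"
    using finite_distinct_list by blast
  have "cone_partition as"
  proof (rule cone_partitionI)
    fix a b s assume "a \<in> set as" "b \<in> set as" "s \<in> cone a" "s \<in> cone b"
    moreover have "stake n s = c" if "c \<in> set as" "s \<in> cone c" for c
      using that as by (auto simp: cone_iff stake_shift)
    ultimately show "a = b" by metis
  next
    fix s :: cantor
    have "s \<in> cone (stake n s)" by (metis in_cone_shift stake_sdrop)
    then show "\<exists>a\<in>set as. s \<in> cone a" using as by (metis (lifting) length_stake mem_Collect_eq)
  qed (use as in auto)
  then show thesis using that as by blast
qed

lemma prefix_substitution_exists:
  assumes "cone_partition as" "cone_partition bs" "length as = length bs"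
  shows "\<exists>g. is_prefix_substitution as bs g"
proof -
  define g where "g s = (THE t. \<exists>i w. i < length as \<and> s = as ! i @- w \<and> t = bs ! i @- w)" for s
  have "g (as ! i @- w) = bs ! i @- w" if "i < length as" for i w
    unfolding g_def
  proof (rule the_equality)
    show "\<exists>k v. k < length as \<and> as ! i @- w = as ! k @- v \<and> bs ! i @- w = bs ! k @- v"
      using that by blast
  next
    fix t assume "\<exists>k v. k < length as \<and> as ! i @- w = as ! k @- v \<and> t = bs ! k @- v"
    then obtain k v where k: "k < length as" "as ! i @- w = as ! k @- v" "t = bs ! k @- v" by blast
    then have "i = k" using cone_partitionD[OF assms(1) that k(1)] by (metis in_cone_shift)
    then show "t = bs ! i @- w" using k by simp
  qed
  then show ?thesis using assms unfolding is_prefix_substitution_def by blast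
qed

section \<open>The group V\<close>

lemma prefix_substitution_bij:
  assumes "is_prefix_substitution as bs g"
  shows "bij g"
proof (rule bijI)
  note a = assms[unfolded is_prefix_substitution_def]
  show "inj g"
  proof (rule injI)
    fix x y assume e: "g x = g y"
    obtain i v where i: "i < length as" "x = as ! i @- v" using a cone_partition_obtain by metis
    obtain j w where j: "j < length as" "y = as ! j @- w" using a cone_partition_obtain by metis
    have "bs ! i @- v = bs ! j @- w" using e a i j by metis
    then have "i = j" using cone_partitionD[of bs i j] a i j by (metis in_cone_shift)
    then show "x = y" using \<open>bs ! i @- v = bs ! j @- w\<close> i j by simp
  qed
  show "surj g"
    unfolding surj_def
  proof
    fix y
    obtain i v where "i < length bs" "y = bs ! i @- v" using a cone_partition_obtain by metis
    then show "\<exists>x. y = g x" using a by metis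
  qed
qed

lemma prefix_substitutionI:
  assumes "cone_partition as" "bij g" "length as = length bs"
    and "\<And>i w. i < length as \<Longrightarrow> g (as ! i @- w) = bs ! i @- w"
  shows "is_prefix_substitution as bs g"
proof -
  have im: "cone (bs ! i) = g ` cone (as ! i)" if "i < length as" for i
    using assms(4)[OF that] by (auto simp: cone_def image_def)
  have "cone_partition bs"
    unfolding cone_partition_def disjoint_family_on_def
  proof (intro conjI ballI impI)
    fix i j assume "i \<in> {..<length bs}" "j \<in> {..<length bs}" "i \<noteq> j"
    then have "cone (as ! i) \<inter> cone (as ! j) = {}" and "i < length as" "j < length as"
      using assms(1,3) unfolding cone_partition_def disjoint_family_on_def by auto
    then show "cone (bs ! i) \<inter> cone (bs ! j) = {}"
      using im assms(2) by (metis bij_def image_Int image_empty)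
  next
    have "(\<Union>i<length bs. cone (bs ! i)) = g ` (\<Union>i<length as. cone (as ! i))"
      using im assms(3) by auto
    also have "\<dots> = UNIV" using assms(1,2) unfolding cone_partition_def by (simp add: bij_def)
    finally show "(\<Union>i<length bs. cone (bs ! i)) = UNIV" .
  qed
  then show ?thesis using assms unfolding is_prefix_substitution_def by auto
qed

text \<open>A characterization of V without partitions: bijections that replace every address of some fixed
  depth by another address.  It makes closure under composition direct.\<close>

lemma thompson_V_iff:
  "g \<in> carrier thompson_V \<longleftrightarrow> bij g \<and> (\<exists>n. \<forall>a. length a = n \<longrightarrow> (\<exists>b. \<forall>w. g (a @- w) = b @- w))"
    (is "?L \<longleftrightarrow> ?R")
proof
  assume ?L
  then obtain as bs where p: "is_prefix_substitution as bs g" by (auto simp: thompson_V_def)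
  note q = p[unfolded is_prefix_substitution_def]
  \<comment> \<open>Every address of this depth extends one of the addresses in \<open>as\<close>.\<close>
  define n where "n = Max (length ` set as)"
  have "\<exists>b. \<forall>w. g (a @- w) = b @- w" if n: "length a = n" for a
  proof -
    obtain i v where i: "i < length as" "a @- sconst False = as ! i @- v"
      using q cone_partition_obtain by metis
    have l: "length (as ! i) \<le> n" unfolding n_def using i by auto
    have "take (length (as ! i)) a = stake (length (as ! i)) (a @- sconst False)"
      using l n by (simp add: stake_shift)
    also have "\<dots> = as ! i" by (simp add: i(2) stake_shift)
    finally obtain c where "a = as ! i @ c" by (metis append_take_drop_id)
    then have "g (a @- w) = (bs ! i @ c) @- w" for w using q i(1) by simp
    then show ?thesis by blast
  qed
  then show ?R using prefix_substitution_bij[OF p] by blast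
next
  assume ?R
  then obtain n f where n: "bij g" "\<And>a w. length a = n \<Longrightarrow> g (a @- w) = f a @- w" by metis
  obtain as where as: "cone_partition as" "set as = {a. length a = n}"
    by (rule cone_partition_words)
  have "is_prefix_substitution as (map f as) g"
  proof (rule prefix_substitutionI[OF as(1) n(1)])
    fix i w assume "i < length as"
    moreover from this have "length (as ! i) = n" using as(2) nth_mem by blast
    ultimately show "g (as ! i @- w) = map f as ! i @- w" using n(2) by simp
  qed simp
  then show ?L by (auto simp: thompson_V_def)
qed

lemma thompson_V_comp:
  assumes "f \<in> carrier thompson_V" "g \<in> carrier thompson_V"
  shows "g \<circ> f \<in> carrier thompson_V"
proof -
  obtain m where m: "bij f" "\<And>a. length a = m \<Longrightarrow> \<exists>b. \<forall>w. f (a @- w) = b @- w"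
    using assms(1) unfolding thompson_V_iff by blast
  obtain n where n: "bij g" "\<And>a. length a = n \<Longrightarrow> \<exists>b. \<forall>w. g (a @- w) = b @- w"
    using assms(2) unfolding thompson_V_iff by blast
  \<comment> \<open>The first map replaces the first \<open>m\<close> letters, which leaves at least \<open>n\<close> letters for the second.\<close>
  have "\<exists>c. \<forall>w. (g \<circ> f) (a @- w) = c @- w" if l: "length a = m + n" for a
  proof -
    obtain b where b: "\<And>w. f (take m a @- w) = b @- w" using m(2)[of "take m a"] l by auto
    have fa: "f (a @- w) = (b @ drop m a) @- w" for w
      using b[of "drop m a @- w"] by (metis append_take_drop_id shift_append)
    obtain c where c: "\<And>w. g (take n (b @ drop m a) @- w) = c @- w"
      using n(2)[of "take n (b @ drop m a)"] l by (metis append_take_drop_id diff_add_inverse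
          le_add2 length_append length_drop length_take min_absorb2)
    have "(g \<circ> f) (a @- w) = (c @ drop n (b @ drop m a)) @- w" for w
      using fa[of w] c[of "drop n (b @ drop m a) @- w"]
      by (metis append_take_drop_id comp_apply shift_append)
    then show ?thesis by blast
  qed
  then show ?thesis unfolding thompson_V_iff using m(1) n(1) bij_comp by blast
qed

lemma thompson_V_id: "id \<in> carrier thompson_V"
  unfolding thompson_V_iff by auto

lemma thompson_V_inv:
  assumes "g \<in> carrier thompson_V"
  shows "inv_into UNIV g \<in> carrier thompson_V"
proof -
  obtain as bs where p: "is_prefix_substitution as bs g" using assms by (auto simp: thompson_V_def)
  note q = p[unfolded is_prefix_substitution_def] and b = prefix_substitution_bij[OF p]
  have "is_prefix_substitution bs as (inv_into UNIV g)"
    using q b by (auto simp: is_prefix_substitution_def inv_f_eq bij_is_inj)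
  then show ?thesis by (auto simp: thompson_V_def)
qed

lemma thompson_V_mult: "f \<otimes>\<^bsub>thompson_V\<^esub> g = g \<circ> f"
  by (simp add: thompson_V_def)

lemma thompson_V_one: "\<one>\<^bsub>thompson_V\<^esub> = id"
  by (simp add: thompson_V_def)

lemma thompson_V_bij: "g \<in> carrier thompson_V \<Longrightarrow> bij g"
  by (simp add: thompson_V_iff)

lemma group_thompson_V: "group thompson_V"
proof (rule groupI)
  fix x assume x: "x \<in> carrier thompson_V"
  have "inv_into UNIV x \<otimes>\<^bsub>thompson_V\<^esub> x = \<one>\<^bsub>thompson_V\<^esub>"
    using surj_iff[THEN iffD1, OF bij_is_surj, OF thompson_V_bij[OF x]]
    by (simp add: thompson_V_mult thompson_V_one)
  then show "\<exists>y\<in>carrier thompson_V. y \<otimes>\<^bsub>thompson_V\<^esub> x = \<one>\<^bsub>thompson_V\<^esub>"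
    using thompson_V_inv[OF x] by blast
qed (auto simp: thompson_V_mult thompson_V_one thompson_V_comp thompson_V_id o_assoc)

lemma m_inv_thompson_V:
  assumes "g \<in> carrier thompson_V"
  shows "inv\<^bsub>thompson_V\<^esub> g = inv_into UNIV g"
  using group.inv_equality[OF group_thompson_V _ assms thompson_V_inv[OF assms]]
    surj_iff[THEN iffD1, OF bij_is_surj, OF thompson_V_bij[OF assms]]
  by (simp add: thompson_V_mult thompson_V_one)

section \<open>Cyclically sorted partitions\<close>

text \<open>A list of addresses is a cyclic partition when its cones partition Cantor space and are listed
  in cyclic order, starting anywhere: some rotation of the list is sorted.\<close>

definition cyclic_partition :: "address list \<Rightarrow> bool" where
  "cyclic_partition xs \<longleftrightarrow>
     cone_partition xs \<and> (\<exists>A B. xs = B @ A \<and> sorted_wrt addr_less (A @ B))"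

lemma cyclic_partition_rotate:
  assumes "cyclic_partition (X @ Y)"
  shows "cyclic_partition (Y @ X)"
proof -
  obtain A B where AB: "X @ Y = B @ A" "sorted_wrt addr_less (A @ B)" and p: "cone_partition (X @ Y)"
    using assms unfolding cyclic_partition_def by blast
  have "\<exists>A B. Y @ X = B @ A \<and> sorted_wrt addr_less (A @ B)"
    using AB(1)[unfolded append_eq_append_conv2]
  proof (elim exE disjE conjE)
    fix C assume "X = B @ C" "C @ Y = A"
    then show ?thesis using AB(2) by (intro exI[of _ C] exI[of _ "Y @ B"]) auto
  next
    fix C assume "X @ C = B" "Y = C @ A"
    then show ?thesis using AB(2) by (intro exI[of _ "A @ X"] exI[of _ C]) auto
  qed
  moreover have "cone_partition (Y @ X)" using p cone_partition_mset[of "X @ Y" "Y @ X"] by simp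
  ultimately show ?thesis unfolding cyclic_partition_def by blast
qed

lemma addr_less_append: "addr_less a b \<Longrightarrow> addr_less (a @ c) (b @ d)"
  unfolding addr_less_def by fastforce

lemma addr_less_append1: "addr_less a b \<Longrightarrow> addr_less (a @ c) b"
  and addr_less_append2: "addr_less a b \<Longrightarrow> addr_less a (b @ c)"
  using addr_less_append[of a b c "[]"] addr_less_append[of a b "[]" c] by auto

lemma addr_less_split: "addr_less (a @ [False]) (a @ [True])"
  unfolding addr_less_def by blast

lemma sorted_split:
  "sorted_wrt addr_less (P @ a # Q) \<Longrightarrow>
     sorted_wrt addr_less (P @ (a @ [False]) # (a @ [True]) # Q)"
  by (auto simp: sorted_wrt_append addr_less_append1 addr_less_append2 addr_less_split)

lemma cyclic_partition_split_hd:
  assumes "cyclic_partition (a # Q)"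
  shows "cyclic_partition ((a @ [False]) # (a @ [True]) # Q)"
proof -
  obtain A B where AB: "a # Q = B @ A" "sorted_wrt addr_less (A @ B)" and p: "cone_partition (a # Q)"
    using assms unfolding cyclic_partition_def by blast
  have "\<exists>A B. (a @ [False]) # (a @ [True]) # Q = B @ A \<and> sorted_wrt addr_less (A @ B)"
  proof (cases B)
    case Nil
    then show ?thesis using AB sorted_split[of "[]" a Q]
      by (intro exI[of _ "(a @ [False]) # (a @ [True]) # Q"] exI[of _ "[]"]) auto
  next
    case (Cons b B')
    then show ?thesis using AB sorted_split[of A a B']
      by (intro exI[of _ A] exI[of _ "(a @ [False]) # (a @ [True]) # B'"]) auto
  qed
  then show ?thesis using p cone_partition_split[of "[]" a Q] unfolding cyclic_partition_def by simp
qed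

lemma cyclic_partition_split:
  assumes "cyclic_partition (P @ a # Q)"
  shows "cyclic_partition (P @ (a @ [False]) # (a @ [True]) # Q)"
  using cyclic_partition_rotate[of "(a @ [False]) # (a @ [True]) # Q" P]
    cyclic_partition_split_hd[of a "Q @ P"] cyclic_partition_rotate[OF assms] by simp

text \<open>On pairwise incomparable addresses the lexicographic order of words agrees with
  \<^const>\<open>addr_less\<close>.\<close>

lemma less_imp_addr_less:
  fixes a b :: address
  assumes "a < b" "cone a \<inter> cone b = {}"
  shows "addr_less a b"
proof -
  have "\<nexists>x v. b = a @ x # v"
    using assms(2) cone_append_subset[of a] by (metis in_cone_shift disjoint_iff subsetD)
  then show ?thesis using assms(1)
    unfolding list_less_def lexord_def addr_less_def by auto
qed

lemma sorted_cone_partition: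
  assumes "cone_partition as"
  shows "sorted_wrt addr_less (sort as)"
proof -
  have "sorted_wrt (<) (sort as)"
    using cone_partition_distinct[OF assms] by (simp add: strict_sorted_iff)
  then show ?thesis
    by (rule sorted_wrt_mono_rel[rotated])
       (metis assms cone_partition_disjoint less_imp_addr_less less_irrefl set_sort)
qed

lemma cyclic_partition_sorted:
  "cone_partition as \<Longrightarrow> sorted_wrt addr_less as \<Longrightarrow> cyclic_partition as"
  unfolding cyclic_partition_def by (intro conjI exI[of _ as] exI[of _ "[]"]) auto

lemma cyclic_partition_sort: "cone_partition as \<Longrightarrow> cyclic_partition (sort as)"
  using sorted_cone_partition cyclic_partition_sorted cone_partition_mset mset_sort by metis

text \<open>Both lists may start at any point of the circle; the two offsets add up to the shift \<open>k\<close> in the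
  definition of T.\<close>

lemma thompson_T_I:
  assumes "cyclic_partition xs" "cyclic_partition ys" "is_prefix_substitution xs ys g"
  shows "g \<in> thompson_T"
proof -
  obtain A B where AB: "xs = B @ A" "sorted_wrt addr_less (A @ B)"
    using assms(1) unfolding cyclic_partition_def by blast
  obtain C D where CD: "ys = D @ C" "sorted_wrt addr_less (C @ D)"
    using assms(2) unfolding cyclic_partition_def by blast
  have len: "length xs = length ys" and g: "\<And>i w. i < length xs \<Longrightarrow> g (xs ! i @- w) = ys ! i @- w"
    using assms(3) by (auto simp: is_prefix_substitution_def)
  let ?n = "length xs"
  have p: "cone_partition (A @ B)" "cone_partition (C @ D)"
    using assms(1,2) AB CD cyclic_partition_rotate unfolding cyclic_partition_def by metis+
  have n: "?n \<ge> 1" using cone_partition_not_Nil[OF p(1)] AB(1) by (auto simp: Suc_le_eq)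
  have 1: "(A @ B) ! i = xs ! ((length B + i) mod ?n)" if "i < ?n" for i
    using nth_rotate[OF that, of "length B"] rotate_append[of B A] AB(1) by simp
  have 2: "ys ! i = (C @ D) ! ((length C + i) mod ?n)" if "i < ?n" for i
    using nth_rotate[of i "C @ D" "length C"] rotate_append[of C D] CD(1) that len
    by (simp add: add.commute[of "length D"])
  define k where "k = length B + length C"
  have "g ((A @ B) ! i @- w) = (C @ D) ! nat ((int i + int k) mod int ?n) @- w" if "i < ?n" for i w
  proof -
    have "nat ((int i + int k) mod int ?n) = (i + k) mod ?n"
      by (metis nat_int of_nat_add zmod_int)
    also have "\<dots> = (length C + (length B + i) mod ?n) mod ?n"
      by (simp add: k_def mod_add_right_eq algebra_simps)
    finally show ?thesis using 1[OF that] 2[of "(length B + i) mod ?n"] g[of "(length B + i) mod ?n"]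
        mod_less_divisor[of ?n "length B + i"] n by (simp add: Suc_le_eq)
  qed
  moreover have "g \<in> carrier thompson_V" using assms(3) by (auto simp: thompson_V_def)
  moreover have "length (A @ B) = ?n" "length (C @ D) = ?n" using AB CD len by auto
  ultimately show ?thesis using n p AB(2) CD(2) unfolding thompson_T_def by blast
qed

section \<open>The cyclic order on Cantor space\<close>

text \<open>The lexicographic order on infinite sequences; \<open>n\<close> is the first position of difference.\<close>

definition seq_less :: "cantor \<Rightarrow> cantor \<Rightarrow> bool" where
  "seq_less x y \<longleftrightarrow> (\<exists>n. (\<forall>i<n. x !! i = y !! i) \<and> \<not> x !! n \<and> y !! n)"

text \<open>The points \<open>x\<close>, \<open>y\<close>, \<open>z\<close> are distinct and are met in this order when running once around the circle.\<close>

definition cyc :: "cantor \<Rightarrow> cantor \<Rightarrow> cantor \<Rightarrow> bool" where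
  "cyc x y z \<longleftrightarrow>
     seq_less x y \<and> seq_less y z \<or> seq_less y z \<and> seq_less z x \<or> seq_less z x \<and> seq_less x y"

lemma seq_less_trans:
  assumes "seq_less x y" "seq_less y z"
  shows "seq_less x z"
proof -
  obtain m where m: "\<forall>i<m. x !! i = y !! i" "\<not> x !! m" "y !! m"
    using assms(1) unfolding seq_less_def by blast
  obtain n where n: "\<forall>i<n. y !! i = z !! i" "\<not> y !! n" "z !! n"
    using assms(2) unfolding seq_less_def by blast
  have "m \<noteq> n" using m n by auto
  then show ?thesis unfolding seq_less_def
    using m n by (intro exI[of _ "min m n"]) (auto simp: min_def)
qed

lemma seq_less_irrefl: "\<not> seq_less x x"
  by (auto simp: seq_less_def)

lemma seq_less_total:
  assumes "x \<noteq> y"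
  shows "seq_less x y \<or> seq_less y x"
proof -
  have ex: "\<exists>n. x !! n \<noteq> y !! n"
  proof (rule ccontr)
    assume "\<nexists>n. x !! n \<noteq> y !! n"
    then have "(!!) x = (!!) y" by auto
    then show False using assms by (metis stream_smap_nats)
  qed
  define n where "n = (LEAST n. x !! n \<noteq> y !! n)"
  have "x !! n \<noteq> y !! n" "\<forall>i<n. x !! i = y !! i"
    unfolding n_def using LeastI_ex[OF ex] not_less_Least by blast+
  then show ?thesis unfolding seq_less_def by metis
qed

lemma cyc_exclusive: "cyc x y z \<Longrightarrow> \<not> cyc x z y"
  unfolding cyc_def using seq_less_trans seq_less_irrefl by metis

lemma cyc_rotate: "cyc x y z \<Longrightarrow> cyc y z x"
  unfolding cyc_def by blast

lemma cyc_distinct: "cyc x y z \<Longrightarrow> x \<noteq> y \<and> y \<noteq> z \<and> x \<noteq> z"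
  unfolding cyc_def using seq_less_trans seq_less_irrefl by metis

lemma cyc_total: "x \<noteq> y \<Longrightarrow> y \<noteq> z \<Longrightarrow> x \<noteq> z \<Longrightarrow> cyc x y z \<or> cyc x z y"
  unfolding cyc_def using seq_less_total by metis

lemma seq_less_shift: "seq_less v w \<Longrightarrow> seq_less (a @- v) (a @- w)"
proof (induction a)
  case (Cons c a)
  then obtain n where n: "\<forall>i<n. (a @- v) !! i = (a @- w) !! i" "\<not> (a @- v) !! n" "(a @- w) !! n"
    unfolding seq_less_def by auto
  then show ?case unfolding seq_less_def
    by (intro exI[of _ "Suc n"]) (auto simp: less_Suc_eq_0_disj)
qed simp

lemma addr_less_imp_seq_less:
  assumes "addr_less a b" "x \<in> cone a" "y \<in> cone b"
  shows "seq_less x y"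
proof -
  obtain u v w where u: "a = u @ False # v" "b = u @ True # w"
    using assms(1) unfolding addr_less_def by blast
  have "seq_less (False ## v @- p) (True ## w @- q)" for p q
    unfolding seq_less_def by (intro exI[of _ 0]) auto
  then show ?thesis using seq_less_shift u assms(2,3) by (auto simp: cone_iff)
qed

lemma cyclic_partition_cyc:
  assumes "cyclic_partition (P @ a # Q @ b # R @ c # S)" "x \<in> cone a" "y \<in> cone b" "z \<in> cone c"
  shows "cyc x y z"
proof -
  let ?L = "Q @ b # R @ c # S @ P"
  have "cyclic_partition (a # ?L)"
    using cyclic_partition_rotate[of P "a # Q @ b # R @ c # S"] assms(1) by simp
  then obtain A B where AB: "a # ?L = B @ A" "sorted_wrt addr_less (A @ B)"
    unfolding cyclic_partition_def by blast
  have "sorted_wrt (\<lambda>b c. addr_less a b \<and> addr_less b c \<or> addr_less b c \<and> addr_less c a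
                        \<or> addr_less c a \<and> addr_less a b) ?L"
  proof (cases B)
    case Nil
    then have "sorted_wrt addr_less (a # ?L)" using AB by simp
    then have "sorted_wrt addr_less ?L" "\<forall>b\<in>set ?L. addr_less a b" by simp_all
    then show ?thesis by (metis (mono_tags, lifting) sorted_wrt_mono_rel)
  next
    case (Cons b' B')
    then have L: "?L = B' @ A" and s: "sorted_wrt addr_less (A @ a # B')" using AB by auto
    have 1: "sorted_wrt addr_less A" "sorted_wrt addr_less B'" "\<forall>b\<in>set B'. addr_less a b"
      "\<forall>b\<in>set A. addr_less b a" "\<forall>b\<in>set A. \<forall>c\<in>set B'. addr_less b c"
      using s by (auto simp: sorted_wrt_append)
    show ?thesis unfolding L sorted_wrt_append
      using 1 by (auto intro: sorted_wrt_mono_rel[rotated])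
  qed
  then have "addr_less a b \<and> addr_less b c \<or> addr_less b c \<and> addr_less c a
      \<or> addr_less c a \<and> addr_less a b"
    by (simp add: sorted_wrt_append)
  then show ?thesis unfolding cyc_def using addr_less_imp_seq_less assms(2-4) by blast
qed

section \<open>The group T\<close>

text \<open>An element of T is increasing on an initial segment of Cantor space and on the complementary final
  segment, and maps the final segment below the image of the initial one.\<close>

lemma thompson_T_imp_cyc:
  assumes "g \<in> thompson_T" "cyc x y z"
  shows "cyc (g x) (g y) (g z)"
proof -
  obtain n as cs k where n: "n \<ge> 1" "length as = n" "length cs = n"
    and p: "cone_partition as" and s: "sorted_wrt addr_less as" "sorted_wrt addr_less cs"
    and g: "\<And>i w. i < n \<Longrightarrow> g (as ! i @- w) = cs ! nat ((int i + k) mod int n) @- w"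
    using assms(1) unfolding thompson_T_def by auto
  define m where "m = nat (k mod int n)"
  have m: "m < n" unfolding m_def using n(1) by (simp add: nat_less_iff)
  have sh: "nat ((int i + k) mod int n) = (if i + m < n then i + m else i + m - n)" if "i < n" for i
  proof -
    have "nat ((int i + k) mod int n) = nat ((int i + int m) mod int n)"
      unfolding m_def using n(1) by (simp add: mod_add_right_eq)
    also have "\<dots> = (i + m) mod n" by (metis nat_int of_nat_add zmod_int)
    also have "\<dots> = (if i + m < n then i + m else i + m - n)" using m that by (simp add: mod_if)
    finally show ?thesis .
  qed
  \<comment> \<open>The final segment, on which the shifted index wraps around.\<close>
  define W where "W x \<longleftrightarrow> (\<exists>i<n. i + m \<ge> n \<and> x \<in> cone (as ! i))" for x
  have key: "(W x \<longrightarrow> W y) \<and> (W x = W y \<longrightarrow> seq_less (g x) (g y)) \<and>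
      (W x \<noteq> W y \<longrightarrow> seq_less (g y) (g x))" if "seq_less x y" for x y
  proof -
    obtain i v where i: "i < n" "x = as ! i @- v" using cone_partition_obtain p n(2) by metis
    obtain j w where j: "j < n" "y = as ! j @- w" using cone_partition_obtain p n(2) by metis
    have "\<not> addr_less (as ! j) (as ! i)"
      using addr_less_imp_seq_less that seq_less_trans seq_less_irrefl i j by (metis in_cone_shift)
    then have ij: "i \<le> j" using s(1) i j n(2) by (metis not_less sorted_wrt_nth_less)
    have Wx: "W x \<longleftrightarrow> i + m \<ge> n" and Wy: "W y \<longleftrightarrow> j + m \<ge> n"
      unfolding W_def using cone_partitionD[OF p] i j n(2) by (metis in_cone_shift)+
    have gx: "g x = cs ! (if i + m < n then i + m else i + m - n) @- v"
      and gy: "g y = cs ! (if j + m < n then j + m else j + m - n) @- w"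
      using g sh i j by simp_all
    have lt: "seq_less (cs ! a @- v') (cs ! b @- w')" if "a < b" "b < n" for a b v' w'
      using addr_less_imp_seq_less s(2) that n(3) by (metis in_cone_shift sorted_wrt_nth_less)
    have vw: "seq_less v w" if "i = j"
      using seq_less_total[of v w] seq_less_shift[of w v "as ! i"] \<open>seq_less x y\<close> i j that
        seq_less_trans seq_less_irrefl by metis
    have "seq_less (g x) (g y)" if "W x = W y"
    proof (cases "i = j")
      case True
      then show ?thesis using vw seq_less_shift gx gy by simp
    next
      case False
      then show ?thesis using ij that i j m unfolding Wx Wy gx gy by (auto intro!: lt)
    qed
    moreover have "seq_less (g y) (g x)" if "W x \<noteq> W y"
      using ij that i j m unfolding Wx Wy gx gy by (auto intro!: lt)
    ultimately show ?thesis using ij Wx Wy by auto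
  qed
  have mono: "cyc (g x) (g y) (g z)" if "seq_less x y" "seq_less y z" for x y z
    using key[OF that(1)] key[OF that(2)] key[OF seq_less_trans[OF that]] unfolding cyc_def by argo
  show ?thesis using assms(2) mono cyc_rotate unfolding cyc_def by metis
qed

lemma longest_common_prefix_neq:
  assumes "length xs = length ys" "xs \<noteq> ys"
  obtains P b c R S where "xs = P @ b # R" "ys = P @ c # S" "b \<noteq> c"
proof -
  obtain P xs' ys' where P: "xs = P @ xs'" "ys = P @ ys'" "xs' = [] \<or> ys' = [] \<or> hd xs' \<noteq> hd ys'"
    using longest_common_prefix by blast
  then have "xs' \<noteq> []" "ys' \<noteq> []" using assms by auto
  then show thesis using P that by (metis list.collapse)
qed

lemma thompson_V_sorted:
  assumes "g \<in> carrier thompson_V"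
  obtains as bs where "is_prefix_substitution as bs g" "sorted_wrt addr_less as"
proof -
  obtain as bs where p: "is_prefix_substitution as bs g" using assms by (auto simp: thompson_V_def)
  obtain p where q: "p permutes {..<length as}" "permute_list p as = sort as"
    using mset_eq_permutation[of "sort as" as] by auto
  note d = p[unfolded is_prefix_substitution_def]
  have "is_prefix_substitution (sort as) (permute_list p bs) g"
  proof (rule prefix_substitutionI)
    show "cone_partition (sort as)" using d cone_partition_mset mset_sort by metis
    show "bij g" using prefix_substitution_bij[OF p] .
    fix i w assume "i < length (sort as)"
    then have i: "i < length as" by simp
    then have "p i < length as" using permutes_in_image[OF q(1)] by simp
    then show "g (sort as ! i @- w) = permute_list p bs ! i @- w"
      using d i q(1) by (simp add: permute_list_nth flip: q(2))
  qed (use d in simp)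
  then show thesis using that sorted_cone_partition d by blast
qed

text \<open>Here \<open>a2\<close> follows \<open>a1\<close> immediately in the cyclic order, whereas the nonempty list \<open>G1\<close> lies
  between their images.  If the images of consecutive cones were always adjacent, their list would be
  the cyclically sorted one, and \<open>g\<close> would lie in T.\<close>

lemma discontinuity_exists:
  assumes "g \<in> carrier thompson_V" "g \<notin> thompson_T"
  obtains a1 a2 b1 b2 L G1 G2 where
    "cyclic_partition (a1 # a2 # L)" "cyclic_partition (b1 # G1 @ b2 # G2)" "G1 \<noteq> []"
    "\<And>w. g (a1 @- w) = b1 @- w" "\<And>w. g (a2 @- w) = b2 @- w"
proof -
  obtain as bs where p: "is_prefix_substitution as bs g" "sorted_wrt addr_less as"
    using thompson_V_sorted[OF assms(1)] .
  note d = p(1)[unfolded is_prefix_substitution_def]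
  have as: "cyclic_partition as" using cyclic_partition_sorted d p(2) by blast
  obtain b0 bs' where b0: "bs = b0 # bs'" using d cone_partition_not_Nil by (cases bs) auto
  have "b0 \<in> set (sort bs)" using b0 by (simp only: set_sort list.set_intros)
  then obtain X Y where XY: "sort bs = X @ b0 # Y" by (meson split_list)
  \<comment> \<open>The image cones in cyclic order, starting like \<open>bs\<close>; the discontinuity sits where \<open>bs\<close> first
    deviates from this list.\<close>
  define cs where "cs = b0 # Y @ X"
  have cs: "cyclic_partition cs"
    using cyclic_partition_rotate[of X "b0 # Y"] cyclic_partition_sort[of bs] d
    by (simp add: cs_def flip: XY)
  have "mset cs = mset (sort bs)" unfolding cs_def XY by simp
  then have m: "mset cs = mset bs" by simp
  have "bs \<noteq> cs" using thompson_T_I[OF as _ p(1)] cs assms(2) by blast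
  moreover have "length bs = length cs" using m mset_eq_length by metis
  ultimately obtain Q b c R S where Q: "bs = Q @ b # R" "cs = Q @ c # S" "b \<noteq> c"
    using longest_common_prefix_neq by metis
  have "Q \<noteq> []" using Q b0 unfolding cs_def by auto
  then obtain P a where P: "Q = P @ [a]" by (metis append_butlast_last_id)
  have "distinct bs" using d cone_partition_distinct by blast
  then have "b \<notin> set Q" using Q by auto
  moreover have "b \<in> set cs" using Q m by (metis in_set_conv_decomp mset_eq_setD)
  ultimately have "b \<in> set S" using Q by auto
  then obtain S1 S2 where S: "S = S1 @ b # S2" by (meson split_list)
  have c1: "cyclic_partition (a # (c # S1) @ b # (S2 @ P))"
    using cyclic_partition_rotate[of P "a # c # S1 @ b # S2"] cs Q(2) P S by simp
  let ?i = "length P"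
  have len: "length as = length bs" using d by blast
  have i: "Suc ?i < length as" using len Q P by simp
  have as2: "as = take ?i as @ as ! ?i # as ! Suc ?i # drop (Suc (Suc ?i)) as"
    using i by (metis Cons_nth_drop_Suc Suc_lessD append_take_drop_id)
  have c2: "cyclic_partition (as ! ?i # as ! Suc ?i # drop (Suc (Suc ?i)) as @ take ?i as)"
    using cyclic_partition_rotate[of "take ?i as" "as ! ?i # as ! Suc ?i # drop (Suc (Suc ?i)) as"]
      as as2 by simp
  have "bs ! ?i = a" "bs ! Suc ?i = b" using Q P by (simp_all add: nth_append)
  then have "g (as ! ?i @- w) = a @- w" "g (as ! Suc ?i @- w) = b @- w" for w
    using d i by auto
  then show thesis using that[OF c2 c1] by blast
qed

text \<open>A discontinuity of a map that preserves the cyclic order is impossible: the preimage of a point of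
  the gap would have to lie between two adjacent cones.\<close>

lemma thompson_T_iff_cyc:
  "g \<in> thompson_T \<longleftrightarrow>
     g \<in> carrier thompson_V \<and> (\<forall>x y z. cyc x y z \<longrightarrow> cyc (g x) (g y) (g z))"
proof
  assume "g \<in> thompson_T"
  then show "g \<in> carrier thompson_V \<and> (\<forall>x y z. cyc x y z \<longrightarrow> cyc (g x) (g y) (g z))"
    using thompson_T_imp_cyc by (auto simp: thompson_T_def)
next
  assume g: "g \<in> carrier thompson_V \<and> (\<forall>x y z. cyc x y z \<longrightarrow> cyc (g x) (g y) (g z))"
  show "g \<in> thompson_T"
  proof (rule ccontr)
    assume "g \<notin> thompson_T"
    then obtain a1 a2 b1 b2 L G1 G2 where
      c: "cyclic_partition (a1 # a2 # L)" "cyclic_partition (b1 # G1 @ b2 # G2)" "G1 \<noteq> []"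
        and g12: "\<And>w. g (a1 @- w) = b1 @- w" "\<And>w. g (a2 @- w) = b2 @- w"
      using discontinuity_exists g by metis
    define w where "w = sconst False"
    obtain e G' where e: "G1 = e # G'" using c(3) by (cases G1) auto
    obtain z where z: "g z = e @- w" using thompson_V_bij g by (metis bij_pointE)
    have n: "cyc (g (a1 @- w)) (g z) (g (a2 @- w))"
      unfolding z g12 using cyclic_partition_cyc[of "[]" b1 "[]" e G' b2 G2] c(2) e by simp
    have p: "cone_partition (a1 # a2 # L)" using c(1) by (simp add: cyclic_partition_def)
    have "z \<notin> cone a1" "z \<notin> cone a2"
    proof -
      have dd: "cone_partition (b1 # G1 @ b2 # G2)" using c(2) by (simp add: cyclic_partition_def)
      note dist = cone_partition_distinct[OF dd]
      have "cone e \<inter> cone b1 = {}" "cone e \<inter> cone b2 = {}"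
        using dist e by (intro cone_partition_disjoint[OF dd]; auto)+
      then show "z \<notin> cone a1" "z \<notin> cone a2"
        using z g12 by (metis cone_iff disjoint_iff in_cone_shift)+
    qed
    moreover obtain f where "f \<in> set (a1 # a2 # L)" "z \<in> cone f"
      using cone_partition_obtain[OF p, of z] by (metis in_cone_shift nth_mem)
    ultimately obtain L1 L2 where "L = L1 @ f # L2" "z \<in> cone f" by (auto dest: split_list)
    then have "cyc (a1 @- w) (a2 @- w) z"
      using cyclic_partition_cyc[of "[]" a1 "[]" a2 L1 f L2] c(1) by simp
    then have "cyc (g (a1 @- w)) (g (a2 @- w)) (g z)" using g by blast
    then show False using n cyc_exclusive by blast
  qed
qed

lemma subgroup_thompson_T: "subgroup thompson_T thompson_V"
proof (rule group.subgroupI[OF group_thompson_V])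
  show "thompson_T \<subseteq> carrier thompson_V" by (auto simp: thompson_T_def)
  show "thompson_T \<noteq> {}" using thompson_T_iff_cyc[of id] thompson_V_id by auto
next
  fix g assume g: "g \<in> thompson_T"
  then have V: "g \<in> carrier thompson_V" by (simp add: thompson_T_iff_cyc)
  have "cyc (inv_into UNIV g x) (inv_into UNIV g y) (inv_into UNIV g z)" if "cyc x y z" for x y z
  proof (rule ccontr)
    let ?h = "inv_into UNIV g"
    have gh: "g (?h u) = u" for u using thompson_V_bij[OF V] by (simp add: bij_is_surj surj_f_inv_f)
    assume "\<not> cyc (?h x) (?h y) (?h z)"
    moreover have "?h x \<noteq> ?h y" "?h y \<noteq> ?h z" "?h x \<noteq> ?h z"
      using cyc_distinct[OF that] gh by metis+
    ultimately have "cyc (?h x) (?h z) (?h y)" using cyc_total by blast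
    then have "cyc x z y" using g thompson_T_iff_cyc gh by metis
    then show False using that cyc_exclusive by blast
  qed
  then show "inv\<^bsub>thompson_V\<^esub> g \<in> thompson_T"
    using V thompson_V_inv by (simp add: m_inv_thompson_V thompson_T_iff_cyc)
next
  fix f g assume "f \<in> thompson_T" "g \<in> thompson_T"
  then show "f \<otimes>\<^bsub>thompson_V\<^esub> g \<in> thompson_T"
    by (simp add: thompson_V_mult thompson_T_iff_cyc thompson_V_comp)
qed

text \<open>The swap of \<open>00\<close> and \<open>01\<close> reverses the cyclic order of these two cones and the cone \<open>1\<close>.\<close>

lemma thompson_T_neq_V: "thompson_T \<noteq> carrier thompson_V"
proof -
  let ?as = "[[False, False], [False, True], [True]]" and ?bs = "[[False, True], [False, False], [True]]"
  have c: "cyclic_partition ?as"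
  proof -
    have "cyclic_partition [[]]"
      by (rule cyclic_partition_sorted) (auto simp: cone_partition_iff_count cone_iff)
    then show ?thesis
      using cyclic_partition_split_hd[of "[]" "[]"] cyclic_partition_split_hd[of "[False]" "[[True]]"] by simp
  qed
  then have pa: "cone_partition ?as" by (simp add: cyclic_partition_def)
  moreover have "cone_partition ?bs"
    using pa cone_partition_mset[of ?as ?bs] by simp
  ultimately obtain g where g: "is_prefix_substitution ?as ?bs g"
    using prefix_substitution_exists by fastforce
  define w where "w = sconst False"
  have "g (?as ! i @- w) = ?bs ! i @- w" if "i < 3" for i
    using g that by (auto simp: is_prefix_substitution_def)
  from this[of 0] this[of 1] this[of 2]
  have g3: "g ([False, False] @- w) = [False, True] @- w" "g ([False, True] @- w) = [False, False] @- w"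
    "g ([True] @- w) = [True] @- w" by simp_all
  have 1: "cyc ([False, False] @- w) ([False, True] @- w) ([True] @- w)"
    by (rule cyclic_partition_cyc[of "[]" "[False, False]" "[]" "[False, True]" "[]" "[True]" "[]"])
      (use c in \<open>simp_all only: append_Nil in_cone_shift\<close>)
  have "g \<notin> thompson_T"
  proof
    assume "g \<in> thompson_T"
    from thompson_T_imp_cyc[OF this 1] have "cyc ([False, True] @- w) ([False, False] @- w) ([True] @- w)"
      unfolding g3 .
    then show False using 1 cyc_exclusive cyc_rotate by metis
  qed
  moreover have "g \<in> carrier thompson_V" using g by (auto simp: thompson_V_def)
  ultimately show ?thesis by blast
qed

section \<open>Slides and swaps\<close>

text \<open>The slide of the ordered pair \<open>(b, c)\<close>, described by its values.  The two cones are meant to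
  be disjoint.\<close>

definition is_slide :: "address \<Rightarrow> address \<Rightarrow> (cantor \<Rightarrow> cantor) \<Rightarrow> bool" where
  "is_slide b c f \<longleftrightarrow>
     (\<forall>w. f (b @- False ## w) = b @- w \<and> f (b @- True ## w) = c @- False ## w
        \<and> f (c @- w) = c @- True ## w) \<and>
     (\<forall>s. s \<notin> cone b \<longrightarrow> s \<notin> cone c \<longrightarrow> f s = s)"

text \<open>The swap of \<open>b\<close> and \<open>c\<close> exchanges the two cones by prefix substitution and fixes all other points.\<close>

definition is_swap :: "address \<Rightarrow> address \<Rightarrow> (cantor \<Rightarrow> cantor) \<Rightarrow> bool" where
  "is_swap b c f \<longleftrightarrow>
     (\<forall>w. f (b @- w) = c @- w \<and> f (c @- w) = b @- w) \<and>
     (\<forall>s. s \<notin> cone b \<longrightarrow> s \<notin> cone c \<longrightarrow> f s = s)"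

text \<open>Two disjoint cones are separated when, on the circle, there is a gap between them on both
  sides.\<close>

definition separated :: "address \<Rightarrow> address \<Rightarrow> bool" where
  "separated b c \<longleftrightarrow> (\<exists>G1 G2. G1 \<noteq> [] \<and> G2 \<noteq> [] \<and> cyclic_partition (b # G1 @ c # G2))"

lemma slide_conjugate:
  assumes "bij h" "\<And>w. h (b @- w) = b' @- w" "\<And>w. h (c @- w) = c' @- w" "is_slide b c f"
  shows "is_slide b' c' (h \<circ> f \<circ> inv_into UNIV h)"
proof -
  let ?h = "inv_into UNIV h"
  have h: "?h (b' @- w) = b @- w" "?h (c' @- w) = c @- w" for w
    using assms(1-3) by (simp_all add: inv_f_eq bij_is_inj)
  have hh: "h (?h s) = s" for s using assms(1) by (simp add: bij_is_surj surj_f_inv_f)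
  have "s \<in> cone b'" if "?h s \<in> cone b" for s
    using that hh[of s] assms(2) by (metis cone_iff)
  moreover have "s \<in> cone c'" if "?h s \<in> cone c" for s
    using that hh[of s] assms(3) by (metis cone_iff)
  ultimately show ?thesis using assms(2-4) h hh unfolding is_slide_def comp_apply by metis
qed

lemma slide_in_thompson_T:
  assumes "cyclic_partition (a # b # L)"
  obtains t where "t \<in> thompson_T" "is_slide a b t"
proof -
  let ?xs = "(a @ [False]) # (a @ [True]) # b # L" and ?ys = "a # (b @ [False]) # (b @ [True]) # L"
  have xs: "cyclic_partition ?xs" using cyclic_partition_split[of "[]" a "b # L"] assms by simp
  have ys: "cyclic_partition ?ys" using cyclic_partition_split[of "[a]" b L] assms by simp
  have c: "cone_partition ?xs" "cone_partition ?ys" "cone_partition (a # b # L)"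
    using xs ys assms by (simp_all add: cyclic_partition_def)
  then obtain t where t: "is_prefix_substitution ?xs ?ys t"
    using prefix_substitution_exists[of ?xs ?ys] by auto
  then have T: "t \<in> thompson_T" using xs ys thompson_T_I by blast
  have e: "t (?xs ! i @- w) = ?ys ! i @- w" if "i < length ?xs" for i w
    using t that by (simp only: is_prefix_substitution_def)
  have "t s = s" if s: "s \<notin> cone a" "s \<notin> cone b" for s
  proof -
    obtain i w where i: "i < length (a # b # L)" "s = (a # b # L) ! i @- w"
      using cone_partition_obtain[OF c(3)] by metis
    then obtain j where "i = Suc (Suc j)" using s by (cases i; cases "i - 1") auto
    then show ?thesis using i e[of "Suc (Suc (Suc j))" w] by simp
  qed
  moreover have "t (a @- False ## w) = a @- w" "t (a @- True ## w) = b @- False ## w"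
    "t (b @- w) = b @- True ## w" for w
    using e[of 0 w] e[of 1 w] e[of 2 w] by simp_all
  ultimately show thesis using that T unfolding is_slide_def by blast
qed

lemma lengthen_gap:
  assumes "cyclic_partition (P @ G @ Q)" "G \<noteq> []"
  shows "\<exists>G'. length G' = length G + k \<and> cyclic_partition (P @ G' @ Q)"
proof (induction k)
  case (Suc k)
  then obtain a R where "length (a # R) = length G + k" "cyclic_partition (P @ (a # R) @ Q)"
    using assms(2) by (metis add_is_0 length_0_conv list.exhaust)
  then show ?case using cyclic_partition_split[of P a "R @ Q"]
    by (intro exI[of _ "(a @ [False]) # (a @ [True]) # R"]) simp
qed (use assms in auto)

text \<open>Subdividing cones makes the gaps of both pairs consist of equally many cones, which can then be
  matched in order.\<close>

lemma thompson_T_transitive: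
  assumes "separated b c" "separated b' c'"
  obtains t where "t \<in> thompson_T" "\<And>w. t (b @- w) = b' @- w" "\<And>w. t (c @- w) = c' @- w"
proof -
  obtain G1 G2 where G: "G1 \<noteq> []" "G2 \<noteq> []" "cyclic_partition (b # G1 @ c # G2)"
    using assms(1) unfolding separated_def by blast
  obtain H1 H2 where H: "H1 \<noteq> []" "H2 \<noteq> []" "cyclic_partition (b' # H1 @ c' # H2)"
    using assms(2) unfolding separated_def by blast
  have *: "\<exists>G1' G2'. length G1' = length G1 + k \<and> length G2' = length G2 + l \<and>
      cyclic_partition (b # G1' @ c # G2')"
    if G: "G1 \<noteq> []" "G2 \<noteq> []" "cyclic_partition (b # G1 @ c # G2)" for b c G1 G2 k l
  proof -
    obtain G1' where G1': "length G1' = length G1 + k" "cyclic_partition (b # G1' @ c # G2)"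
      using lengthen_gap[of "[b]" G1 "c # G2" k] G by auto
    obtain G2' where "length G2' = length G2 + l" "cyclic_partition (b # G1' @ c # G2')"
      using lengthen_gap[of "b # G1' @ [c]" G2 "[]" l] G G1' by auto
    then show ?thesis using G1' by blast
  qed
  obtain G1' G2' where G': "length G1' = length G1 + length H1" "length G2' = length G2 + length H2"
    "cyclic_partition (b # G1' @ c # G2')" (is "cyclic_partition ?xs")
    using *[OF G] by blast
  obtain H1' H2' where H': "length H1' = length H1 + length G1" "length H2' = length H2 + length G2"
    "cyclic_partition (b' # H1' @ c' # H2')" (is "cyclic_partition ?ys")
    using *[OF H] by blast
  obtain t where t: "is_prefix_substitution ?xs ?ys t"
    using prefix_substitution_exists[of ?xs ?ys] G' H' by (auto simp: cyclic_partition_def)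
  have e: "t (?xs ! i @- w) = ?ys ! i @- w" if "i < length ?xs" for i w
    using t that by (simp only: is_prefix_substitution_def)
  have "t (b @- w) = b' @- w" "t (c @- w) = c' @- w" for w
    using e[of 0 w] e[of "Suc (length G1')" w] G' H' by (simp_all add: nth_append)
  then show thesis using that thompson_T_I G' H' t by blast
qed

lemma separated_sym: "separated b c \<Longrightarrow> separated c b"
  unfolding separated_def using cyclic_partition_rotate[of "b # G" "c # G'" for G G']
  by (metis append_Cons)

lemma slideD:
  assumes "is_slide b c f"
  shows "f (b @- False ## w) = b @- w" "f (b @- True ## w) = c @- False ## w"
    "f (c @- w) = c @- True ## w" "s \<notin> cone b \<Longrightarrow> s \<notin> cone c \<Longrightarrow> f s = s"
  using assms unfolding is_slide_def by blast+

lemma swapD: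
  assumes "is_swap b c f"
  shows "f (b @- w) = c @- w" "f (c @- w) = b @- w" "s \<notin> cone b \<Longrightarrow> s \<notin> cone c \<Longrightarrow> f s = s"
  using assms unfolding is_swap_def by blast+

lemma swapI:
  assumes "\<And>x w. f (b @- x ## w) = c @- x ## w" "\<And>x w. f (c @- x ## w) = b @- x ## w"
    and "\<And>s. s \<notin> cone b \<Longrightarrow> s \<notin> cone c \<Longrightarrow> f s = s"
  shows "is_swap b c f"
  using assms(3) assms(1,2)[of "shd w" "stl w" for w] unfolding is_swap_def by simp

lemma cone_disjointD:
  assumes "cone b \<inter> cone c = {}"
  shows "b @- v \<notin> cone (c @ x)" "c @- v \<notin> cone (b @ x)" "b @- v \<notin> cone c" "c @- v \<notin> cone b"
proof -
  show *: "b @- v \<notin> cone c" "c @- v \<notin> cone b" using assms in_cone_shift by blast+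
  show "b @- v \<notin> cone (c @ x)" using *(1) cone_append_subset[of c x] by blast
  show "c @- v \<notin> cone (b @ x)" using *(2) cone_append_subset[of b x] by blast
qed

text \<open>Write \<open>b0\<close>, \<open>b1\<close>, \<open>c0\<close>, \<open>c1\<close> for the halves of the cones.  The first two slides compose to the
  3-cycle \<open>c0 \<mapsto> c1 \<mapsto> b0 \<mapsto> c0\<close>, the last two to \<open>b0 \<mapsto> b1 \<mapsto> c1 \<mapsto> b0\<close>; together they exchange
  \<open>b0\<close> with \<open>c0\<close> and \<open>b1\<close> with \<open>c1\<close>.\<close>

lemma swap_of_slides:
  assumes d: "cone b \<inter> cone c = {}"
    and "is_slide c (b @ [False]) f1" "is_slide (b @ [False]) c f2"
    and "is_slide b (c @ [True]) f3" "is_slide (c @ [True]) b f4"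
  shows "is_swap b c (f4 \<circ> f3 \<circ> f2 \<circ> f1)"
proof (rule swapI)
  note n = cone_disjointD[OF d]
  note s = slideD[OF assms(2)] slideD[OF assms(3)] slideD[OF assms(4)] slideD[OF assms(5)]
  note s' = s[unfolded shift_append shift.simps]
  show "(f4 \<circ> f3 \<circ> f2 \<circ> f1) (b @- x ## w) = c @- x ## w" for x w
    by (cases x) (simp_all add: s' n)
  show "(f4 \<circ> f3 \<circ> f2 \<circ> f1) (c @- x ## w) = b @- x ## w" for x w
    by (cases x) (simp_all add: s' n)
  fix t assume t: "t \<notin> cone b" "t \<notin> cone c"
  then have "t \<notin> cone (b @ [False])" "t \<notin> cone (c @ [True])"
    using cone_append_subset[of c "[True]"] cone_append_subset[of b "[False]"] by blast+
  then show "(f4 \<circ> f3 \<circ> f2 \<circ> f1) t = t" using t s(4,8,12,16) by simp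
qed

lemma swap_of_half_swaps:
  assumes d: "cone b \<inter> cone c = {}"
    and "is_swap (b @ [False]) (c @ [False]) f" "is_swap (b @ [True]) (c @ [True]) g"
  shows "is_swap b c (g \<circ> f)"
proof (rule swapI)
  note n = cone_disjointD[OF d]
  note s = swapD[OF assms(2)] swapD[OF assms(3)]
  note s' = s[unfolded shift_append shift.simps]
  show "(g \<circ> f) (b @- x ## w) = c @- x ## w" for x w
    by (cases x) (simp_all add: s' n)
  show "(g \<circ> f) (c @- x ## w) = b @- x ## w" for x w
    by (cases x) (simp_all add: s' n)
  fix t assume t: "t \<notin> cone b" "t \<notin> cone c"
  then have "t \<notin> cone (b @ [x])" "t \<notin> cone (c @ [x])" for x
    using cone_append_subset[of c "[x]"] cone_append_subset[of b "[x]"] by blast+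
  then show "(g \<circ> f) t = t" using s(3,6) by simp
qed

section \<open>Subgroups properly containing T\<close>

text \<open>The subgroups of V that properly contain T.\<close>

locale thompson_T_overgroup =
  fixes K
  assumes subgroup: "subgroup K thompson_V" and contains_T: "thompson_T \<subset> K"
begin

lemma in_V: "f \<in> K \<Longrightarrow> f \<in> carrier thompson_V"
  using subgroup.subset[OF subgroup] by blast

lemma comp_closed: "f \<in> K \<Longrightarrow> g \<in> K \<Longrightarrow> g \<circ> f \<in> K"
  using subgroup.m_closed[OF subgroup, of f g] by (simp add: thompson_V_mult)

lemma inv_closed: "f \<in> K \<Longrightarrow> inv_into UNIV f \<in> K"
  using subgroup.m_inv_closed[OF subgroup, of f] by (simp add: m_inv_thompson_V in_V)

lemma conj_closed: "f \<in> K \<Longrightarrow> h \<in> K \<Longrightarrow> h \<circ> f \<circ> inv_into UNIV h \<in> K"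
  by (intro comp_closed inv_closed)

lemma id_closed: "id \<in> K"
  using subgroup.one_closed[OF subgroup] by (simp add: thompson_V_one)

text \<open>The slide of two cones adjacent at a discontinuity of \<open>g\<close> lies in T, and its conjugate by \<open>g\<close> is
  the slide of the image cones.  Taking only the halves next to the discontinuity guarantees a gap also
  on the far side of the images.\<close>

lemma slide_between_separated:
  obtains b c f where "separated b c" "is_slide b c f" "f \<in> K"
proof -
  obtain g where g: "g \<in> K" "g \<notin> thompson_T" using contains_T by blast
  obtain a1 a2 b1 b2 L G1 G2 where
    a: "cyclic_partition (a1 # a2 # L)" and b: "cyclic_partition (b1 # G1 @ b2 # G2)" "G1 \<noteq> []"
      and e: "\<And>w. g (a1 @- w) = b1 @- w" "\<And>w. g (a2 @- w) = b2 @- w"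
    using discontinuity_exists[OF in_V[OF g(1)] g(2)] by metis
  let ?a1 = "a1 @ [True]" and ?a2 = "a2 @ [False]" and ?b1 = "b1 @ [True]" and ?b2 = "b2 @ [False]"
  have "cyclic_partition (?a1 # a2 # L @ [a1 @ [False]])"
    using cyclic_partition_split[of "[]" a1 "a2 # L"] a
      cyclic_partition_rotate[of "[a1 @ [False]]" "?a1 # a2 # L"] by simp
  then have "cyclic_partition (?a1 # ?a2 # (a2 @ [True]) # L @ [a1 @ [False]])"
    using cyclic_partition_split[of "[?a1]" a2 "L @ [a1 @ [False]]"] by simp
  then obtain t where t: "t \<in> thompson_T" "is_slide ?a1 ?a2 t" by (rule slide_in_thompson_T)
  have "is_slide ?b1 ?b2 (g \<circ> t \<circ> inv_into UNIV g)"
    by (rule slide_conjugate[OF thompson_V_bij[OF in_V[OF g(1)]] _ _ t(2)]) (simp_all add: e)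
  moreover have "g \<circ> t \<circ> inv_into UNIV g \<in> K" using t(1) contains_T g(1) conj_closed by blast
  moreover have "separated ?b1 ?b2"
  proof -
    have "cyclic_partition (?b1 # G1 @ b2 # G2 @ [b1 @ [False]])"
      using cyclic_partition_split[of "[]" b1 "G1 @ b2 # G2"] b(1)
        cyclic_partition_rotate[of "[b1 @ [False]]" "?b1 # G1 @ b2 # G2"] by simp
    then have "cyclic_partition (?b1 # G1 @ ?b2 # (b2 @ [True]) # G2 @ [b1 @ [False]])"
      using cyclic_partition_split[of "?b1 # G1" b2 "G2 @ [b1 @ [False]]"] by simp
    then show ?thesis unfolding separated_def using b(2) by blast
  qed
  ultimately show thesis using that by blast
qed

lemma slide_in:
  assumes "separated b c"
  obtains f where "is_slide b c f" "f \<in> K"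
proof -
  obtain b0 c0 f where f: "separated b0 c0" "is_slide b0 c0 f" "f \<in> K"
    by (rule slide_between_separated)
  obtain t where t: "t \<in> thompson_T" "\<And>w. t (b0 @- w) = b @- w" "\<And>w. t (c0 @- w) = c @- w"
    using thompson_T_transitive[OF f(1) assms] by blast
  have "t \<in> K" using t contains_T by blast
  then show thesis
    using that slide_conjugate[OF thompson_V_bij[OF in_V] t(2,3) f(2)] conj_closed[OF f(3)] by blast
qed

lemma swap_separated_in:
  assumes "separated b c"
  obtains f where "is_swap b c f" "f \<in> K"
proof -
  obtain G1 G2 where G: "G1 \<noteq> []" "G2 \<noteq> []" "cyclic_partition (b # G1 @ c # G2)"
    using assms unfolding separated_def by blast
  have "cyclic_partition ((b @ [False]) # ((b @ [True]) # G1) @ c # G2)"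
    using cyclic_partition_split[of "[]" b "G1 @ c # G2"] G by simp
  then have 1: "separated (b @ [False]) c" unfolding separated_def using G by blast
  have "cyclic_partition (b # (G1 @ [c @ [False]]) @ (c @ [True]) # G2)"
    using cyclic_partition_split[of "b # G1" c G2] G by simp
  then have 2: "separated b (c @ [True])" unfolding separated_def using G by blast
  have p: "cone_partition (b # G1 @ c # G2)" using G by (simp add: cyclic_partition_def)
  have d: "cone b \<inter> cone c = {}"
    using cone_partition_distinct[OF p] by (intro cone_partition_disjoint[OF p]) auto
  obtain f1 where f1: "is_slide c (b @ [False]) f1" "f1 \<in> K" using separated_sym[OF 1] by (rule slide_in)
  obtain f2 where f2: "is_slide (b @ [False]) c f2" "f2 \<in> K" using 1 by (rule slide_in)
  obtain f3 where f3: "is_slide b (c @ [True]) f3" "f3 \<in> K" using 2 by (rule slide_in)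
  obtain f4 where f4: "is_slide (c @ [True]) b f4" "f4 \<in> K" using separated_sym[OF 2] by (rule slide_in)
  show thesis using that[OF swap_of_slides[OF d f1(1) f2(1) f3(1) f4(1)]] f1 f2 f3 f4 comp_closed by blast
qed

text \<open>The cones \<open>b\<close> and \<open>c\<close> may be adjacent, but their left halves are separated from each other by
  the right halves, and conversely.\<close>

lemma swap_in:
  assumes p: "cone_partition as" and bc: "b \<in> set as" "c \<in> set as" "b \<noteq> c"
  obtains f where "is_swap b c f" "f \<in> K"
proof -
  have "b \<in> set (sort as)" using bc by simp
  then obtain X Y where XY: "sort as = X @ b # Y" by (meson split_list)
  have "c \<in> set (X @ b # Y)" using bc by (simp flip: XY)
  then have "c \<in> set (Y @ X)" using bc by auto
  then obtain G1 G2 where G: "Y @ X = G1 @ c # G2" by (meson split_list)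
  have "cyclic_partition (b # G1 @ c # G2)"
    using cyclic_partition_rotate[of X "b # Y"] cyclic_partition_sort[OF p] XY G by simp
  then have q: "cyclic_partition ((b @ [False]) # ((b @ [True]) # G1) @ (c @ [False]) # (c @ [True]) # G2)"
    using cyclic_partition_split[of "[]" b "G1 @ c # G2"]
      cyclic_partition_split[of "(b @ [False]) # (b @ [True]) # G1" c G2] by simp
  then have "separated (b @ [False]) (c @ [False])" unfolding separated_def by blast
  then obtain f where f: "is_swap (b @ [False]) (c @ [False]) f" "f \<in> K" by (rule swap_separated_in)
  have "cyclic_partition ((b @ [True]) # (G1 @ [c @ [False]]) @ (c @ [True]) # (G2 @ [b @ [False]]))"
    using cyclic_partition_rotate[of "[b @ [False]]"
        "(b @ [True]) # G1 @ (c @ [False]) # (c @ [True]) # G2"] q by simp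
  then have "separated (b @ [True]) (c @ [True])" unfolding separated_def by blast
  then obtain g where g: "is_swap (b @ [True]) (c @ [True]) g" "g \<in> K" by (rule swap_separated_in)
  show thesis
    using that[OF swap_of_half_swaps[OF cone_partition_disjoint[OF p bc] f(1) g(1)]] comp_closed f g by blast
qed

lemma cone_permutation_in:
  assumes p: "cone_partition as" and "\<pi> permutes {..<length as}"
    and "\<And>i w. i < length as \<Longrightarrow> f (as ! i @- w) = as ! \<pi> i @- w"
  shows "f \<in> K"
  using assms(2) finite_lessThan assms(3)
proof (induction \<pi> arbitrary: f rule: permutes_induct)
  case id
  have "f s = s" for s
  proof -
    obtain i w where "i < length as" "s = as ! i @- w" using cone_partition_obtain[OF p] by blast
    then show ?thesis using id by simp
  qed
  then have "f = id" by auto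
  then show ?case by (simp only: id_closed)
next
  case (swap a b \<pi>)
  have ab: "a < length as" "b < length as" "a \<noteq> b" using swap.hyps by simp_all
  then have "as ! a \<noteq> as ! b"
    using cone_partition_distinct[OF p] by (simp add: nth_eq_iff_index_eq)
  then obtain h where h: "is_swap (as ! a) (as ! b) h" "h \<in> K"
    using swap_in[OF p nth_mem[OF ab(1)] nth_mem[OF ab(2)]] by blast
  have tr: "h (as ! j @- w) = as ! Transposition.transpose a b j @- w" if j: "j < length as" for j w
  proof -
    consider "j = a" | "j = b" | "j \<noteq> a" "j \<noteq> b" by blast
    then show ?thesis
    proof cases
      case 3
      then have "as ! j @- w \<notin> cone (as ! a)" "as ! j @- w \<notin> cone (as ! b)"
        using cone_partitionD[OF p j ab(1) in_cone_shift] cone_partitionD[OF p j ab(2) in_cone_shift]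
        by blast+
      then show ?thesis using swapD(3)[OF h(1)] 3 by simp
    qed (simp_all add: swapD(1,2)[OF h(1)])
  qed
  have "h \<circ> f \<in> K"
  proof (rule swap.IH)
    fix i w assume i: "i < length as"
    have "\<pi> i < length as" using permutes_in_image[OF swap.hyps(4)] i by simp
    then have "Transposition.transpose a b (\<pi> i) < length as"
      using ab by (simp add: Transposition.transpose_def)
    then show "(h \<circ> f) (as ! i @- w) = as ! \<pi> i @- w"
      using swap.prems[OF i, of w] by (simp add: tr)
  qed
  then have "inv_into UNIV h \<circ> (h \<circ> f) \<in> K" using comp_closed inv_closed[OF h(2)] by blast
  moreover have "inv_into UNIV h \<circ> (h \<circ> f) = f"
    using thompson_V_bij[OF in_V[OF h(2)]] by (simp add: o_assoc bij_is_inj)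
  ultimately show ?case by simp
qed

lemma eq_V: "K = carrier thompson_V"
proof (intro equalityI subsetI)
  fix g assume "g \<in> carrier thompson_V"
  then obtain as bs where pg: "is_prefix_substitution as bs g" "sorted_wrt addr_less as"
    by (rule thompson_V_sorted)
  note d = pg(1)[unfolded is_prefix_substitution_def]
  obtain \<pi> where pi: "\<pi> permutes {..<length bs}" "permute_list \<pi> bs = sort bs"
    using mset_eq_permutation[of "sort bs" bs] by auto
  have cp: "cyclic_partition as" "cyclic_partition (sort bs)"
    using d pg(2) cyclic_partition_sorted cyclic_partition_sort by blast+
  then obtain t where t: "is_prefix_substitution as (sort bs) t"
    using prefix_substitution_exists[of as "sort bs"] d by (auto simp: cyclic_partition_def)
  have T: "t \<in> K" using thompson_T_I[OF cp t] contains_T by blast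
  \<comment> \<open>\<open>t\<close> carries the cones of \<open>as\<close> to those of \<open>bs\<close> in sorted order, so \<open>g\<close> and \<open>t\<close> differ by a
    permutation of the cones of \<open>bs\<close>.\<close>
  let ?u = "t \<circ> inv_into UNIV g"
  have "?u (bs ! i @- w) = bs ! \<pi> i @- w" if i: "i < length bs" for i w
  proof -
    have "inv_into UNIV g (bs ! i @- w) = as ! i @- w"
      using d i prefix_substitution_bij[OF pg(1)] by (simp add: inv_f_eq bij_is_inj)
    moreover have "t (as ! i @- w) = sort bs ! i @- w"
      using t i d by (simp add: is_prefix_substitution_def)
    ultimately show ?thesis using i pi(1) by (simp add: permute_list_nth flip: pi(2))
  qed
  then have u: "?u \<in> K" using cone_permutation_in[of bs \<pi> ?u] d pi(1) by blast
  have "inv_into UNIV ?u \<circ> t \<in> K" using comp_closed[OF T inv_closed[OF u]] .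
  moreover have "(inv_into UNIV ?u \<circ> t) s = g s" for s
    using bij_is_inj[OF thompson_V_bij[OF in_V[OF u]]] bij_is_inj[OF prefix_substitution_bij[OF pg(1)]]
    by (simp add: inv_f_eq)
  ultimately show "g \<in> K" by (metis ext)
qed (rule in_V)

end

theorem theorem3p7:
  shows "maximal_subgroup thompson_T thompson_V"
proof (intro maximal_subgroup.intro maximal_subgroup_axioms.intro)
  show "\<not> (\<exists>K. subgroup K thompson_V \<and> thompson_T \<subset> K \<and> K \<subset> carrier thompson_V)"
    using thompson_T_overgroup.eq_V unfolding thompson_T_overgroup_def by blast
qed (fact subgroup_thompson_T group_thompson_V thompson_T_neq_V)+

end
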